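(* Let $T\subseteq\omega^{<\omega_1}$ be a normal, $\omega$-splitting $\ell_\infty$-tree. The group $([T]^{<\omega},\triangle)$, when equipped with $\mathcal U^\infty_T=\{U^\infty_n(t):n<\omega,\ t\in T\}$ as the local base of the identity $\emptyset$, becomes a topological group.
   Context: $\omega^{<\omega_1}$ is the set of functions from countable ordinals to $\omega$; $[T]^{<\omega}$ is the set of finite subsets of $T$; $\triangle$ is symmetric difference. Consider $T\subseteq\omega^{<\omega_1}$ ordered by strict end-extension $\subsetneq$ and closed under restrictions to smaller ordinals, so $T$ is a tree in which the height of $t$ is $\mathrm{ht}(t)=\mathrm{dom}(t)$; $T_\alpha$ is the set of nodes of height $\alpha$ and $T\restriction\delta=\bigcup_{\gamma<\delta}T_\gamma$. $T$ is an $\omega_1$-tree if it has height $\omega_1$ and all levels are countable; it is normal if whenever $s\in T$ and $\mathrm{ht}(s)<\alpha<\omega_1$ there is $t\in T_\alpha$ with $s\subsetneq t$; it is $\omega$-splitting if every node has infinitely many immediate successors. For $f,g\in\omega^{<\omega_1}$ let $\|f\|_\infty=\sup\{f(\gamma):\gamma\in\mathrm{dom}(f)\}$, and let $f-g$ be the function with domain $\mathrm{dom}(f)\cap\mathrm{dom}(g)$ and $(f-g)(\gamma)=|f(\gamma)-g(\gamma)|$. An $\omega_1$-tree $T\subseteq\omega^{<\omega_1}$ is an $\ell_\infty$-tree if $\|s-t\|_\infty<\omega$ for all $s,t\in T$. For $t\in T$ and $n<\omega$ let $F^\infty_n(t)=\{s\in T\restriction\mathrm{ht}(t):\|s-t\|_\infty\le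 n\}$ and $U^\infty_n(t)=\{a\in[T]^{<\omega}:a\cap F^\infty_n(t)=\emptyset\}$. *)

theory Defs
  imports
    "HOL-Analysis.Analysis"
    "HOL-Algebra.Group"
    "HOL-Library.Extended_Nat"
    "HOL-Library.Countable_Set_Type"
begin

section \<open>The ordinal \<open>\<omega>\<^sub>1\<close>\<close>

text \<open>
  The elements of this type are the countable ordinals: it carries the well-order
  \<open>cardSuc natLeq\<close>, whose order type is the first uncountable ordinal. An ordinal
  \<open>\<alpha>\<close>, seen as a set, is the initial segment \<open>{..<\<alpha>}\<close>.
\<close>

typedef omega1 = "Field (cardSuc natLeq)"
proof -
  have "infinite (Field (cardSuc natLeq))"
    using cardSuc_finite[OF natLeq_Card_order] by (simp add: Field_natLeq)
  then show ?thesis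
    using infinite_imp_nonempty by blast
qed

lemma cardSuc_natLeq_Well_order: "Well_order (cardSuc natLeq)"
  using cardSuc_Card_order[OF natLeq_Card_order] by (simp add: card_order_on_well_order_on)

instantiation omega1 :: wellorder
begin

definition less_eq_omega1 :: "omega1 \<Rightarrow> omega1 \<Rightarrow> bool"
  where "x \<le> y \<longleftrightarrow> (Rep_omega1 x, Rep_omega1 y) \<in> cardSuc natLeq"

definition less_omega1 :: "omega1 \<Rightarrow> omega1 \<Rightarrow> bool"
  where "x < y \<longleftrightarrow> x \<le> y \<and> \<not> y \<le> (x::omega1)"

instance
proof -
  let ?r = "cardSuc natLeq"
  have W: "wo_rel ?r"
    using cardSuc_natLeq_Well_order by (simp add: wo_rel_def)
  have refl: "x \<le> x" for x :: omega1
    using wo_rel.REFL[OF W] Rep_omega1[of x] by (simp add: less_eq_omega1_def refl_on_def)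
  have trans: "x \<le> z" if "x \<le> y" "y \<le> z" for x y z :: omega1
    using wo_rel.TRANS[OF W] that unfolding less_eq_omega1_def trans_def by blast
  have antisym: "x = y" if "x \<le> y" "y \<le> x" for x y :: omega1
    using wo_rel.ANTISYM[OF W] that unfolding less_eq_omega1_def antisym_def
    by (metis Rep_omega1_inject)
  have total: "x \<le> y \<or> y \<le> x" for x y :: omega1
    using wo_rel.TOTALS[OF W] Rep_omega1 unfolding less_eq_omega1_def by blast
  have wfP: "P a" if step: "\<And>x. (\<And>y. y < x \<Longrightarrow> P y) \<Longrightarrow> P x"
    for P and a :: omega1
  proof -
    have "wf (inv_image (?r - Id) Rep_omega1)"
      using wo_rel.WF[OF W] by (rule wf_inv_image)
    then show ?thesis
    proof (induction a rule: wf_induct_rule)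
      case (less x)
      show ?case
      proof (rule step)
        fix y assume "y < x"
        then have "(y, x) \<in> inv_image (?r - Id) Rep_omega1"
          using refl[of x] by (auto simp: less_omega1_def less_eq_omega1_def)
        then show "P y"
          by (rule less)
      qed
    qed
  qed
  show "OFCLASS(omega1, wellorder_class)"
  proof
    show "x < y \<longleftrightarrow> x \<le> y \<and> \<not> y \<le> x" for x y :: omega1
      by (rule less_omega1_def)
  qed (fact refl trans antisym total wfP)+
qed

end

lemma countable_lessThan_omega1:
  includes cardinal_syntax
  shows "countable {..<\<alpha>::omega1}"
proof -
  let ?r = "cardSuc natLeq"
  have "|underS ?r (Rep_omega1 \<alpha>)| <o ?r"
    by (rule card_of_underS[OF cardSuc_Card_order[OF natLeq_Card_order] Rep_omega1])
  then have "|underS ?r (Rep_omega1 \<alpha>)| \<le>o natLeq"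
    using cardSuc_ordLeq_ordLess[OF natLeq_Card_order card_of_Card_order] by blast
  then have "countable (underS ?r (Rep_omega1 \<alpha>))"
    by (simp add: countable_card_le_natLeq)
  moreover have "Rep_omega1 ` {..<\<alpha>} \<subseteq> underS ?r (Rep_omega1 \<alpha>)"
    by (auto simp: underS_def less_le less_eq_omega1_def Rep_omega1_inject)
  ultimately have "countable (Rep_omega1 ` {..<\<alpha>})"
    using countable_subset by blast
  then show ?thesis
    by (rule countable_image_inj_on) (simp add: inj_on_def Rep_omega1_inject)
qed

lemma uncountable_omega1:
  includes cardinal_syntax
  shows "uncountable (UNIV :: omega1 set)"
proof
  let ?r = "cardSuc natLeq"
  assume "countable (UNIV :: omega1 set)"
  then have "countable (range Rep_omega1)"
    by (rule countable_image)
  then have "|Field ?r| \<le>o natLeq"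
    by (simp add: countable_card_le_natLeq type_definition.Rep_range[OF type_definition_omega1])
  then have "?r \<le>o natLeq"
    using card_of_Field_ordIso[OF cardSuc_Card_order[OF natLeq_Card_order]]
      ordIso_ordLeq_trans ordIso_symmetric by blast
  then show False
    using cardSuc_greater[OF natLeq_Card_order] not_ordLess_ordLeq by blast
qed


section \<open>Trees of functions from countable ordinals to \<open>\<omega>\<close>\<close>

text \<open>
  A function with domain \<open>\<alpha> < \<omega>\<^sub>1\<close> is a partial map whose domain is \<open>{..<\<alpha>}\<close>.
  End-extension is then \<open>\<subseteq>\<^sub>m\<close>, and restriction is \<open>|`\<close>.
\<close>

type_synonym oseq = "omega1 \<rightharpoonup> nat"

definition oseqs :: "oseq set"
  where "oseqs = {t. \<exists>\<alpha>. dom t = {..<\<alpha>}}"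

definition ht :: "oseq \<Rightarrow> omega1"
  where "ht t = (THE \<alpha>. dom t = {..<\<alpha>})"

lemma ht_eqI: "dom t = {..<\<alpha>} \<Longrightarrow> ht t = \<alpha>"
  by (auto simp: ht_def)

definition strict_ext :: "oseq \<Rightarrow> oseq \<Rightarrow> bool"
  where "strict_ext s t \<longleftrightarrow> s \<subseteq>\<^sub>m t \<and> s \<noteq> t"

definition tree :: "oseq set \<Rightarrow> bool"
  where "tree T \<longleftrightarrow> T \<subseteq> oseqs \<and> (\<forall>t\<in>T. \<forall>\<alpha><ht t. t |` {..<\<alpha>} \<in> T)"

definition level :: "oseq set \<Rightarrow> omega1 \<Rightarrow> oseq set"
  where "level T \<alpha> = {t \<in> T. ht t = \<alpha>}"

definition below :: "oseq set \<Rightarrow> omega1 \<Rightarrow> oseq set"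
  where "below T \<delta> = (\<Union>\<gamma><\<delta>. level T \<gamma>)"

text \<open>
  The height of a tree is the least ordinal at which its level is empty. All nodes of
  \<open>T\<close> have countable height, so it is \<open>\<omega>\<^sub>1\<close> iff no level below \<open>\<omega>\<^sub>1\<close> is empty.
\<close>

definition omega1_tree :: "oseq set \<Rightarrow> bool"
  where "omega1_tree T \<longleftrightarrow> tree T \<and> (\<forall>\<alpha>. level T \<alpha> \<noteq> {} \<and> countable (level T \<alpha>))"

definition normal_tree :: "oseq set \<Rightarrow> bool"
  where "normal_tree T \<longleftrightarrow> (\<forall>s\<in>T. \<forall>\<alpha>>ht s. \<exists>t\<in>level T \<alpha>. strict_ext s t)"

definition immediate_successors :: "oseq set \<Rightarrow> oseq \<Rightarrow> oseq set"
  where "immediate_successors T t =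
    {s \<in> T. strict_ext t s \<and> \<not> (\<exists>u\<in>T. strict_ext t u \<and> strict_ext u s)}"

definition omega_splitting :: "oseq set \<Rightarrow> bool"
  where "omega_splitting T \<longleftrightarrow> (\<forall>t\<in>T. infinite (immediate_successors T t))"

definition sup_norm :: "oseq \<Rightarrow> enat"
  where "sup_norm f = (SUP \<gamma>\<in>dom f. enat (the (f \<gamma>)))"

definition abs_diff :: "oseq \<Rightarrow> oseq \<Rightarrow> oseq"
  where "abs_diff f g = (\<lambda>\<gamma>. if \<gamma> \<in> dom f \<inter> dom g
    then Some (nat \<bar>int (the (f \<gamma>)) - int (the (g \<gamma>))\<bar>) else None)"

definition linf_tree :: "oseq set \<Rightarrow> bool"
  where "linf_tree T \<longleftrightarrow> omega1_tree T \<and> (\<forall>s\<in>T. \<forall>t\<in>T. sup_norm (abs_diff s t) < \<infinity>)"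


section \<open>The group of finite subsets and its local base\<close>

definition F_inf :: "oseq set \<Rightarrow> nat \<Rightarrow> oseq \<Rightarrow> oseq set"
  where "F_inf T n t = {s \<in> below T (ht t). sup_norm (abs_diff s t) \<le> enat n}"

definition U_inf :: "oseq set \<Rightarrow> nat \<Rightarrow> oseq \<Rightarrow> oseq set set"
  where "U_inf T n t = {a \<in> Fpow T. a \<inter> F_inf T n t = {}}"

definition U_base :: "oseq set \<Rightarrow> oseq set set set"
  where "U_base T = {U_inf T n t | n t. t \<in> T}"

definition fin_group :: "'a set \<Rightarrow> 'a set monoid"
  where "fin_group T = \<lparr>carrier = Fpow T, monoid.mult = (\<lambda>a b. sym_diff a b), one = {}\<rparr>"

text \<open>Topological groups are not required to be Hausdorff.\<close>

definition topological_group :: "('a, 'b) monoid_scheme \<Rightarrow> 'a topology \<Rightarrow> bool"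
  where "topological_group G X \<longleftrightarrow>
    group G \<and> topspace X = carrier G \<and>
    continuous_map (prod_topology X X) X (\<lambda>(x, y). x \<otimes>\<^bsub>G\<^esub> y) \<and>
    continuous_map X X (\<lambda>x. inv\<^bsub>G\<^esub> x)"

text \<open>The members of a local base are open neighbourhoods.\<close>

definition local_base_at :: "'a topology \<Rightarrow> 'a \<Rightarrow> 'a set set \<Rightarrow> bool"
  where "local_base_at X x \<B> \<longleftrightarrow>
    (\<forall>U\<in>\<B>. openin X U \<and> x \<in> U) \<and>
    (\<forall>W. openin X W \<and> x \<in> W \<longrightarrow> (\<exists>U\<in>\<B>. U \<subseteq> W))"

end

(* A local base at the identity determines the topology of a group by translation. Conversely, a
   nonempty downward directed family of subgroups of a commutative group is a local base of a group
   topology. Each U_n(t) is a subgroup, and the family is directed: if ht s \<le> ht t and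
   ||s - t|| \<le> c, then F_m(s) is contained in F_(m+c)(t) by the triangle inequality. *)

theory Submission
  imports Defs "HOL-Algebra.Coset"
begin

section \<open>Group topologies from a local base\<close>

text \<open>Left translations are homeomorphisms, so the neighbourhoods of \<open>x\<close> are the
  translates by \<open>x\<close> of those of the identity. The right-hand side does not mention
  \<open>X\<close>; this gives uniqueness later.\<close>

lemma topological_group_openin_iff:
  fixes G (structure)
  assumes "topological_group G X" and base: "local_base_at X \<one> \<B>"
  shows "openin X W \<longleftrightarrow> W \<subseteq> carrier G \<and> (\<forall>x\<in>W. \<exists>U\<in>\<B>. x <# U \<subseteq> W)"
proof -
  have G: "group G" and top: "topspace X = carrier G"
    and mult: "continuous_map (prod_topology X X) X (\<lambda>(x, y). x \<otimes> y)"
    using assms(1) by (auto simp: topological_group_def)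
  interpret group G by fact
  have translation: "continuous_map X X (\<lambda>y. x \<otimes> y)" if "x \<in> carrier G" for x
  proof -
    have "continuous_map X (prod_topology X X) (\<lambda>y. (x, y))"
      using that top by (simp add: continuous_map_pairwise o_def)
    from continuous_map_compose[OF this mult] show ?thesis
      by (simp add: o_def)
  qed
  show ?thesis
  proof (intro iffI conjI ballI)
    assume W: "openin X W"
    then show sub: "W \<subseteq> carrier G"
      using openin_subset top by metis
    fix x assume x: "x \<in> W"
    have "openin X {y \<in> topspace X. x \<otimes> y \<in> W}"
      using translation W x sub openin_continuous_map_preimage by blast
    moreover have "\<one> \<in> {y \<in> topspace X. x \<otimes> y \<in> W}"
      using x sub top by auto
    ultimately obtain U where "U \<in> \<B>" "U \<subseteq> {y \<in> topspace X. x \<otimes> y \<in> W}"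
      using base unfolding local_base_at_def by meson
    then show "\<exists>U\<in>\<B>. x <# U \<subseteq> W"
      by (auto simp: l_coset_def)
  next
    assume W: "W \<subseteq> carrier G \<and> (\<forall>x\<in>W. \<exists>U\<in>\<B>. x <# U \<subseteq> W)"
    show "openin X W"
    proof (subst openin_subopen, intro ballI)
      fix x assume x: "x \<in> W"
      with W obtain U where U: "U \<in> \<B>" "x <# U \<subseteq> W" and xG: "x \<in> carrier G"
        by blast
      \<comment> \<open>The coset of \<open>U\<close> at \<open>x\<close> written as a preimage of
        \<open>U\<close> under translation by \<open>inv x\<close>, which makes its openness
        visible.\<close>
      let ?V = "{y \<in> topspace X. inv x \<otimes> y \<in> U}"
      have "openin X ?V"
        using openin_continuous_map_preimage[OF translation[OF inv_closed[OF xG]]] U(1) base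
        by (auto simp: local_base_at_def)
      moreover have "x \<in> ?V"
        using U xG top base by (auto simp: local_base_at_def)
      moreover have "?V \<subseteq> x <# U"
      proof
        fix y assume "y \<in> ?V"
        then have "y = x \<otimes> (inv x \<otimes> y)" "inv x \<otimes> y \<in> U"
          using xG top by (auto simp flip: m_assoc)
        then show "y \<in> x <# U"
          unfolding l_coset_def by blast
      qed
      ultimately show "\<exists>V. openin X V \<and> x \<in> V \<and> V \<subseteq> W"
        using U by blast
    qed
  qed
qed

text \<open>Members that are subgroups have cosets that are themselves open and are closed under the
  operation and inverses. Hence one \<open>U\<close> serves wherever a general neighbourhood base
  would call for a smaller member.\<close>

lemma (in comm_group) ex1_subgroup_topology:
  assumes ne: "\<B> \<noteq> {}" and sub: "\<And>U. U \<in> \<B> \<Longrightarrow> subgroup U G"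
    and directed: "\<And>U V. U \<in> \<B> \<Longrightarrow> V \<in> \<B> \<Longrightarrow> \<exists>Z\<in>\<B>. Z \<subseteq> U \<inter> V"
  shows "\<exists>!X. topological_group G X \<and> local_base_at X \<one> \<B>"
proof (rule ex_ex1I)
  \<comment> \<open>By \<open>topological_group_openin_iff\<close> this is the only possible notion
    of open set.\<close>
  define P where "P W \<longleftrightarrow> W \<subseteq> carrier G \<and> (\<forall>x\<in>W. \<exists>U\<in>\<B>. x <# U \<subseteq> W)" for W
  have coset_closed: "x <# U \<subseteq> carrier G" if "U \<in> \<B>" "x \<in> carrier G" for x U
    using l_coset_subset_G[OF subgroup.subset[OF sub]] that by blast
  have "istopology P"
    unfolding istopology_def
  proof safe
    fix V W assume VW: "P V" "P W"
    have "\<exists>Z\<in>\<B>. x <# Z \<subseteq> V \<inter> W" if x: "x \<in> V" "x \<in> W" for x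
    proof -
      \<comment> \<open>The two sets may use different members at \<open>x\<close>; directedness
        supplies one inside both.\<close>
      obtain A B where AB: "A \<in> \<B>" "B \<in> \<B>" "x <# A \<subseteq> V" "x <# B \<subseteq> W"
        using VW x unfolding P_def by (elim conjE) (drule (1) bspec, drule (1) bspec, blast)
      obtain Z where Z: "Z \<in> \<B>" "Z \<subseteq> A \<inter> B"
        using directed[OF AB(1,2)] by blast
      have "x <# Z \<subseteq> (x <# A) \<inter> (x <# B)"
        using Z(2) by (auto simp: l_coset_def)
      then show ?thesis
        using Z(1) AB(3,4) by (meson Int_greatest le_infE order_trans)
    qed
    then show "P (V \<inter> W)"
      using VW unfolding P_def by blast
  next
    fix \<K> assume "\<forall>K\<in>\<K>. P K"
    then show "P (\<Union>\<K>)"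
      unfolding P_def by (meson Sup_upper UnionE Sup_least subset_trans)
  qed
  define X where "X = topology P"
  have openin_X: "openin X = P"
    unfolding X_def using \<open>istopology P\<close> by (rule topology_inverse')
  \<comment> \<open>Some member must exist to witness this at each point, hence the use of
    \<open>ne\<close>.\<close>
  have "P (carrier G)"
    using ne coset_closed unfolding P_def by blast
  then have top: "topspace X = carrier G"
    by (metis P_def openin_X openin_subset openin_topspace subset_antisym)
  have open_coset: "openin X (x <# U)" if U: "U \<in> \<B>" and x: "x \<in> carrier G" for x U
  proof -
    \<comment> \<open>Any point of a coset represents it, so \<open>U\<close> itself is the witness
      at every \<open>y\<close>.\<close>
    have "y <# U \<subseteq> x <# U" if "y \<in> x <# U" for y
      using l_repr_independence[OF that x sub[OF U]] by simp
    then show ?thesis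
      unfolding openin_X P_def using U coset_closed[OF U x] by auto
  qed
  have self_coset: "x \<in> x <# U" if "U \<in> \<B>" "x \<in> carrier G" for x U
    using that sub[of U] subgroup.one_closed unfolding l_coset_def by force
  have "continuous_map (prod_topology X X) X (\<lambda>(x, y). x \<otimes> y)"
    unfolding continuous_map_def
  proof (intro conjI allI impI)
    show "(\<lambda>(x, y). x \<otimes> y) \<in> topspace (prod_topology X X) \<rightarrow> topspace X"
      by (auto simp: top)
    fix W assume W: "openin X W"
    let ?S = "{p \<in> topspace (prod_topology X X). (case p of (x, y) \<Rightarrow> x \<otimes> y) \<in> W}"
    show "openin (prod_topology X X) ?S"
    proof (unfold openin_prod_topology_alt, intro allI impI)
      fix x y assume "(x, y) \<in> ?S"
      then have xy: "x \<in> carrier G" "y \<in> carrier G" "x \<otimes> y \<in> W"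
        by (auto simp: top)
      then obtain U where U: "U \<in> \<B>" "(x \<otimes> y) <# U \<subseteq> W"
        using W unfolding openin_X P_def by blast
      \<comment> \<open>Commutativity gathers the two errors: (xu)(yv) = (xy)(uv), and uv stays in
        the subgroup \<open>U\<close>.\<close>
      have "(x <# U) \<times> (y <# U) \<subseteq> ?S"
      proof (rule subrelI)
        fix a b assume "(a, b) \<in> (x <# U) \<times> (y <# U)"
        then obtain u v where uv: "u \<in> U" "v \<in> U" "a = x \<otimes> u" "b = y \<otimes> v"
          unfolding l_coset_def by auto
        then have "u \<in> carrier G" "v \<in> carrier G"
          using sub[OF U(1)] subgroup.mem_carrier by metis+
        moreover from this have "a \<otimes> b = (x \<otimes> y) \<otimes> (u \<otimes> v)"
          using uv xy by (simp add: m_ac)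
        moreover have "u \<otimes> v \<in> U"
          using uv sub[OF U(1)] subgroup.m_closed by metis
        ultimately show "(a, b) \<in> ?S"
          using U(2) uv xy unfolding l_coset_def by (auto simp: top)
      qed
      then show "\<exists>A B. openin X A \<and> openin X B \<and> x \<in> A \<and> y \<in> B \<and> A \<times> B \<subseteq> ?S"
        using open_coset self_coset U(1) xy(1,2) by meson
    qed
  qed
  moreover have "continuous_map X X (\<lambda>x. inv x)"
    unfolding continuous_map_def
  proof (intro conjI allI impI)
    show "(\<lambda>x. inv x) \<in> topspace X \<rightarrow> topspace X"
      by (auto simp: top)
    fix W assume W: "openin X W"
    have "\<exists>U\<in>\<B>. x <# U \<subseteq> {x \<in> topspace X. inv x \<in> W}" if x: "x \<in> carrier G" "inv x \<in> W" for x
    proof -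
      obtain U where U: "U \<in> \<B>" "inv x <# U \<subseteq> W"
        using x W unfolding openin_X P_def by blast
      \<comment> \<open>Again by commutativity, the inverse of xu is the inverse of x times that of
        u, and the latter lies in \<open>U\<close>.\<close>
      have "x \<otimes> u \<in> carrier G \<and> inv (x \<otimes> u) \<in> W" if u: "u \<in> U" for u
      proof -
        have "u \<in> carrier G" "inv u \<in> U"
          using u sub[OF U(1)] subgroup.mem_carrier subgroup.m_inv_closed by metis+
        then show ?thesis
          using x U(2) unfolding l_coset_def by (auto simp: inv_mult)
      qed
      then show ?thesis
        using U(1) unfolding l_coset_def top by blast
    qed
    then show "openin X {x \<in> topspace X. inv x \<in> W}"
      unfolding openin_X P_def by (auto simp: top)
  qed
  ultimately have "topological_group G X"
    using is_group top by (simp add: topological_group_def)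
  moreover have "local_base_at X \<one> \<B>"
    unfolding local_base_at_def
  proof (intro conjI ballI allI impI)
    fix U assume U: "U \<in> \<B>"
    then have "\<one> <# U = U"
      using lcos_mult_one[OF subgroup.subset[OF sub]] by blast
    then show "openin X U" "\<one> \<in> U"
      using open_coset[OF U] self_coset[OF U] by force+
  next
    fix W assume "openin X W \<and> \<one> \<in> W"
    then obtain U where U: "U \<in> \<B>" "\<one> <# U \<subseteq> W"
      unfolding openin_X P_def by blast
    then show "\<exists>U\<in>\<B>. U \<subseteq> W"
      using lcos_mult_one[OF subgroup.subset[OF sub]] by metis
  qed
  ultimately show "\<exists>X. topological_group G X \<and> local_base_at X \<one> \<B>"
    by blast
next
  fix X Y
  assume X: "topological_group G X \<and> local_base_at X \<one> \<B>"
    and Y: "topological_group G Y \<and> local_base_at Y \<one> \<B>"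
  have "openin X W \<longleftrightarrow> openin Y W" for W
    using topological_group_openin_iff[of G X \<B> W] topological_group_openin_iff[of G Y \<B> W] X Y
    by blast
  then show "X = Y"
    by (simp add: topology_eq)
qed


section \<open>The neighbourhoods of the empty set\<close>

lemma fin_group_simps [simp]:
  "carrier (fin_group T) = Fpow T" "\<one>\<^bsub>fin_group T\<^esub> = {}"
  "a \<otimes>\<^bsub>fin_group T\<^esub> b = sym_diff a b"
  by (simp_all add: fin_group_def)

lemma comm_group_fin_group: "comm_group (fin_group T)"
proof (rule comm_groupI)
  show "\<exists>b\<in>carrier (fin_group T). b \<otimes>\<^bsub>fin_group T\<^esub> a = \<one>\<^bsub>fin_group T\<^esub>"
    if "a \<in> carrier (fin_group T)" for a
    using that by auto
qed (auto simp: Fpow_def)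

lemma inv_fin_group:
  assumes "a \<in> Fpow T"
  shows "inv\<^bsub>fin_group T\<^esub> a = a"
proof -
  interpret comm_group "fin_group T"
    by (rule comm_group_fin_group)
  show ?thesis
    using assms by (intro inv_equality) simp_all
qed

text \<open>A symmetric difference lies inside the union, so it misses \<open>F_inf T n t\<close>
  when both sets do; every element is its own inverse.\<close>

lemma subgroup_U_inf: "subgroup (U_inf T n t) (fin_group T)"
  by (rule subgroup.intro) (auto simp: U_inf_def inv_fin_group Fpow_def)

text \<open>Replaces a supremum in the extended naturals by pointwise integer inequalities, to which
  linear arithmetic applies. An empty common domain fits in, as the empty supremum is 0.\<close>

lemma sup_norm_abs_diff_le_iff:
  "sup_norm (abs_diff f g) \<le> enat n \<longleftrightarrow>
    (\<forall>\<gamma>\<in>dom f \<inter> dom g. \<bar>int (the (f \<gamma>)) - int (the (g \<gamma>))\<bar> \<le> int n)"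
proof -
  have "dom (abs_diff f g) = dom f \<inter> dom g"
    by (auto simp: abs_diff_def dom_def)
  then show ?thesis
    by (simp add: sup_norm_def SUP_le_iff abs_diff_def nat_le_iff)
qed

text \<open>The node of greater height absorbs the other: a node close to \<open>s\<close> is close
  to \<open>t\<close>, by comparison through \<open>s\<close>.\<close>

lemma F_inf_Un_subset:
  assumes T: "linf_tree T" and s: "s \<in> T" and t: "t \<in> T" and le: "ht s \<le> ht t"
  shows "\<exists>k. F_inf T m s \<union> F_inf T n t \<subseteq> F_inf T k t"
proof -
  \<comment> \<open>\<open>ht\<close> is a definite description; membership in \<open>oseqs\<close>
    makes it denote the actual domain.\<close>
  have dom_eq: "dom u = {..<ht u}" if "u \<in> T" for u
  proof -
    have "T \<subseteq> oseqs"
      using T unfolding linf_tree_def omega1_tree_def tree_def by blast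
    with that obtain \<alpha> where "dom u = {..<\<alpha>}"
      unfolding oseqs_def by blast
    then show ?thesis
      using ht_eqI by metis
  qed
  \<comment> \<open>The only use of the finite distance between nodes of an \<ell>-infinity
    tree.\<close>
  obtain c where c: "sup_norm (abs_diff s t) \<le> enat c"
    using T s t unfolding linf_tree_def by (metis less_infinityE order_refl)
  \<comment> \<open>The radius m + c comes from the triangle inequality; the maximum with n keeps
    \<open>F_inf T n t\<close> inside as well.\<close>
  have "F_inf T m s \<subseteq> F_inf T (max n (m + c)) t"
  proof
    fix u assume u: "u \<in> F_inf T m s"
    then have uT: "u \<in> T" and less: "ht u < ht s"
      by (auto simp: F_inf_def below_def level_def)
    have "\<bar>int (the (u \<gamma>)) - int (the (t \<gamma>))\<bar> \<le> int (max n (m + c))"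
      if "\<gamma> \<in> dom u \<inter> dom t" for \<gamma>
    proof -
      \<comment> \<open>Since \<open>u\<close> is lower than \<open>s\<close>, its domain lies in
        that of \<open>s\<close>, so the intermediate value of \<open>s\<close> at \<gamma>
        exists.\<close>
      have "\<gamma> \<in> dom u \<inter> dom s" "\<gamma> \<in> dom s \<inter> dom t"
        using that less s uT by (auto simp: dom_eq)
      then have "\<bar>int (the (u \<gamma>)) - int (the (s \<gamma>))\<bar> \<le> int m"
        "\<bar>int (the (s \<gamma>)) - int (the (t \<gamma>))\<bar> \<le> int c"
        using u c unfolding F_inf_def sup_norm_abs_diff_le_iff by blast+
      then show ?thesis
        by linarith
    qed
    then show "u \<in> F_inf T (max n (m + c)) t"
      using uT less le by (auto simp: F_inf_def below_def level_def sup_norm_abs_diff_le_iff)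
  qed
  moreover have "F_inf T n t \<subseteq> F_inf T (max n (m + c)) t"
    unfolding F_inf_def by (auto elim!: order_trans)
  ultimately show ?thesis
    by blast
qed

lemma U_base_directed:
  assumes T: "linf_tree T" and U: "U \<in> U_base T" and V: "V \<in> U_base T"
  shows "\<exists>Z\<in>U_base T. Z \<subseteq> U \<inter> V"
proof -
  obtain m s n t where st: "s \<in> T" "t \<in> T" and UV: "U = U_inf T m s" "V = U_inf T n t"
    using U V unfolding U_base_def by blast
  \<comment> \<open>Heights are linearly ordered; \<open>r\<close> is whichever of \<open>s\<close>
    and \<open>t\<close> is at least as high. A larger \<open>F_inf\<close> gives a smaller
    \<open>U_inf\<close>.\<close>
  obtain k r where "r \<in> T" "F_inf T m s \<union> F_inf T n t \<subseteq> F_inf T k r"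
    using F_inf_Un_subset[OF T] st by (metis Un_commute linear)
  then have "U_inf T k r \<in> U_base T" "U_inf T k r \<subseteq> U \<inter> V"
    unfolding UV U_base_def U_inf_def by blast+
  then show ?thesis
    by blast
qed

theorem theorem6p6:
  fixes T :: "oseq set"
  assumes "linf_tree T" and "normal_tree T" and "omega_splitting T"
  shows "\<exists>!X. topological_group (fin_group T) X \<and>
    local_base_at X \<one>\<^bsub>fin_group T\<^esub> (U_base T)"
proof (rule comm_group.ex1_subgroup_topology[OF comm_group_fin_group])
  \<comment> \<open>No level of an \<omega>1-tree is empty.\<close>
  have "T \<noteq> {}"
    using assms(1) by (auto simp: linf_tree_def omega1_tree_def level_def)
  then show "U_base T \<noteq> {}"
    by (auto simp: U_base_def)
  show "subgroup U (fin_group T)" if "U \<in> U_base T" for U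
    using that subgroup_U_inf by (auto simp: U_base_def)
qed (rule U_base_directed[OF assms(1)])

end
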